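(* Let $f:[0,\infty)\to\mathbb{R}$ be a function that is differentiable on $(0,\infty)$, let $0<u<v$, and suppose $f'\in L[u,v]$. Let $q\ge 1$. If $|f'|^q$ is $s$-convex (in the second sense) on $[u,v]$ for some fixed $s\in(0,1]$, then for each $x\in[u,v]$, $$\left|\frac{(v-x)(vf(v)-uf(x))+(x-u)(vf(x)-uf(u))}{(v-u)^2}-\frac{1}{v-u}\int_u^v f(\mu)\,d\mu\right|$$ $$\le \frac{(v-x)^2}{(v-u)^2}A^{1-\frac1q}(u,v)\left(\frac{1}{(s+1)(s+2)}\right)^{\frac1q}\Big(((s+1)u+v)|f'(x)|^q+((s+1)v+u)|f'(v)|^q\Big)^{\frac1q}$$ $$+\frac{(x-u)^2}{(v-u)^2}A^{1-\frac1q}(u,v)\left(\frac{1}{(s+1)(s+2)}\right)^{\frac1q}\Big(((s+1)v+u)|f'(x)|^q+((s+1)u+v)|f'(u)|^q\Big)^{\frac1q}.$$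
   Context: $L[u,v]$ denotes the space of Lebesgue integrable functions on $[u,v]$. For $s\in(0,1]$, a nonnegative function $g$ on an interval $[u,v]$ is $s$-convex (in the second sense) on $[u,v]$ if $g(ty+(1-t)z)\le t^s g(y)+(1-t)^s g(z)$ for all $y,z\in[u,v]$ and $t\in[0,1]$. $A(u,v)=\frac{u+v}{2}$ is the arithmetic mean, and $A^{r}(u,v)=(A(u,v))^{r}$. *)

theory Defs
  imports "HOL-Analysis.Analysis"
begin

text \<open>\<open>s\<close>-convexity in the second sense; it is meant for \<open>s \<in> {0<..1}\<close> and \<open>S\<close> an interval.
  Since \<open>0 powr s = 0\<close> also holds in Isabelle, \<open>powr\<close> agrees with the usual power
  at \<open>t = 0\<close> and \<open>t = 1\<close>.\<close>

definition s_convex_on :: "real \<Rightarrow> real set \<Rightarrow> (real \<Rightarrow> real) \<Rightarrow> bool" where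
  "s_convex_on s S g \<longleftrightarrow>
     (\<forall>y\<in>S. 0 \<le> g y) \<and>
     (\<forall>y\<in>S. \<forall>z\<in>S. \<forall>t\<in>{0..1}.
        g (t * y + (1 - t) * z) \<le> t powr s * g y + (1 - t) powr s * g z)"

definition arith_mean :: "real \<Rightarrow> real \<Rightarrow> real" where
  "arith_mean u v = (u + v) / 2"

end

theory Submission
  imports Defs
begin

text \<open>
  Write \<open>w t = t * v + (1 - t) * u\<close>. For a segment from \<open>a\<close> to \<open>b\<close>, integrating
  \<open>(b - a) * w t * f' (t * b + (1 - t) * a)\<close> by parts over \<open>[0, 1]\<close> gives the boundary terms
  \<open>v * f b - u * f a\<close> and, since \<open>w' = v - u\<close>, a multiple of the integral of \<open>f\<close>. Doing this for
  the segments \<open>[x, v]\<close> and \<open>[u, x]\<close>, multiplying each identity by its \<open>b - a\<close> and adding, gives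
  exactly \<open>(v - u)\<^sup>2\<close> times the quantity between the bars on the left-hand side
  (lemma \<open>weighted_derivative_has_integral\<close>).

  Each of the two integrals is then estimated by the power-mean inequality with weight \<open>w\<close>
  (lemma \<open>weighted_power_mean_bound\<close>), whose total mass is the arithmetic mean of \<open>u\<close> and \<open>v\<close>:
  \<open>s\<close>-convexity bounds \<open>\<bar>f'\<bar> powr q\<close> along the segment by
  \<open>t powr s * \<bar>f' b\<bar> powr q + (1 - t) powr s * \<bar>f' a\<bar> powr q\<close>, and the integral of \<open>w\<close> against this
  bound is explicit (lemma \<open>weighted_s_convex_majorant_has_integral\<close>).

  The power-mean inequality is reached through its tangent lines, that is, through Young's
  inequality with a free parameter that is optimised after integration. In this form the explicit
  majorant of \<open>\<bar>f'\<bar> powr q\<close> can be inserted pointwise, before anything is integrated.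
\<close>

text \<open>Young's inequality for the exponents \<open>1 / q\<close> and \<open>1 - 1 / q\<close>. The right-hand side is affine
  in \<open>a powr q\<close> and is the tangent line, at \<open>a = c\<close>, of the concave map \<open>a powr q \<mapsto> a\<close>.\<close>

lemma le_powr_tangent:
  fixes a c q :: real
  assumes "0 \<le> a" "0 < c" "1 \<le> q"
  shows "a \<le> (1 / q) * c powr (1 - q) * a powr q + (1 - 1 / q) * c"
proof (cases "a = 0")
  case True
  then show ?thesis using assms by simp
next
  case False
  then have a: "a > 0" using assms by simp
  have "(c powr (1 - q) * a powr q) powr (1 / q) * c powr (1 - 1 / q)
      = c powr ((1 - q) / q + (1 - 1 / q)) * a"
    using a assms by (simp add: powr_mult powr_powr powr_add)
  also have "(1 - q) / q + (1 - 1 / q) = 0"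
    using assms by (simp add: field_simps)
  finally show ?thesis
    using Youngs_inequality_0[of "1 / q" "1 - 1 / q" "c powr (1 - q) * a powr q" c] a assms
    by simp
qed

text \<open>The power-mean inequality, with a majorant \<open>h\<close> in place of \<open>\<bar>g\<bar> powr q\<close>. Integrating the
  tangent-line bound against \<open>w\<close> gives a family of estimates indexed by the point of tangency \<open>c\<close>;
  the best one is \<open>c = (B / A) powr (1 / q)\<close>, while for \<open>B = 0\<close> the point \<open>c\<close> tends to \<open>0\<close>.\<close>

lemma weighted_power_mean_bound:
  fixes w g h :: "'a::euclidean_space \<Rightarrow> real"
  assumes q: "1 \<le> q" and w: "\<And>t. t \<in> S \<Longrightarrow> 0 \<le> w t"
    and gh: "\<And>t. t \<in> S \<Longrightarrow> \<bar>g t\<bar> powr q \<le> h t"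
    and A: "(w has_integral A) S" "0 < A"
    and B: "((\<lambda>t. w t * h t) has_integral B) S"
    and I: "((\<lambda>t. w t * g t) has_integral I) S"
  shows "\<bar>I\<bar> \<le> A powr (1 - 1 / q) * B powr (1 / q)"
proof -
  have tangent: "\<bar>I\<bar> \<le> (1 / q) * c powr (1 - q) * B + (1 - 1 / q) * c * A" if c: "c > 0" for c
  proof -
    let ?m = "\<lambda>t. (1 / q) * c powr (1 - q) * (w t * h t) + (1 - 1 / q) * c * w t"
    have m: "(?m has_integral (1 / q) * c powr (1 - q) * B + (1 - 1 / q) * c * A) S"
      by (intro has_integral_add has_integral_mult_right A B)
    have "\<bar>w t * g t\<bar> \<le> ?m t" if t: "t \<in> S" for t
    proof -
      have "\<bar>g t\<bar> \<le> (1 / q) * c powr (1 - q) * \<bar>g t\<bar> powr q + (1 - 1 / q) * c"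
        by (rule le_powr_tangent) (use c q in auto)
      also have "\<dots> \<le> (1 / q) * c powr (1 - q) * h t + (1 - 1 / q) * c"
        by (intro add_right_mono mult_left_mono gh t) (use q in auto)
      finally have "w t * \<bar>g t\<bar> \<le> w t * ((1 / q) * c powr (1 - q) * h t + (1 - 1 / q) * c)"
        using w[OF t] by (rule mult_left_mono)
      then show ?thesis using w[OF t] by (simp add: abs_mult algebra_simps)
    qed
    then have "norm (integral S (\<lambda>t. w t * g t)) \<le> integral S ?m"
      using m I by (intro integral_norm_bound_integral) (auto simp: integrable_on_def)
    then show ?thesis using m I by (simp add: integral_unique)
  qed
  have h: "0 \<le> h t" if "t \<in> S" for t
    using gh[OF that] powr_ge_zero[of "\<bar>g t\<bar>" q] by linarith
  have "0 \<le> B"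
    using has_integral_nonneg[OF B] w h by simp
  then consider "B = 0" | "B > 0" by linarith
  then show ?thesis
  proof cases
    case 1
    have "I = 0"
    proof (rule ccontr)
      assume "I \<noteq> 0"
      \<comment> \<open>Tangency at \<open>c = \<bar>I\<bar> / (2 * A)\<close> already gives \<open>\<bar>I\<bar> \<le> \<bar>I\<bar> / 2\<close>.\<close>
      then have "\<bar>I\<bar> \<le> (1 - 1 / q) * (\<bar>I\<bar> / (2 * A)) * A"
        using tangent[of "\<bar>I\<bar> / (2 * A)"] 1 A by simp
      also have "\<dots> \<le> \<bar>I\<bar> / 2"
        using A q by (simp add: field_simps)
      finally show False using \<open>I \<noteq> 0\<close> by simp
    qed
    then show ?thesis by simp
  next
    case 2
    define c where "c = (B / A) powr (1 / q)"
    have c: "c > 0" using 2 A by (simp add: c_def)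
    have "c powr (1 - q) * B = c * A"
      using 2 A q by (simp add: c_def powr_powr powr_diff)
    then have "\<bar>I\<bar> \<le> (1 / q) * (c * A) + (1 - 1 / q) * c * A"
      using tangent[OF c] by (simp add: mult.assoc)
    also have "\<dots> = c * A" by (simp add: algebra_simps)
    also have "\<dots> = A powr (1 - 1 / q) * B powr (1 / q)"
      using 2 A by (simp add: c_def powr_divide powr_diff)
    finally show ?thesis .
  qed
qed

lemma linear_weight_has_integral:
  fixes u v :: real
  shows "((\<lambda>t. t * v + (1 - t) * u) has_integral (u + v) / 2) {0..1}"
proof -
  have "((\<lambda>t. t * v + (1 - t) * u) has_integral
      ((1\<^sup>2 / 2 * v + (1 - 1\<^sup>2 / 2) * u) - (0\<^sup>2 / 2 * v + (0 - 0\<^sup>2 / 2) * u))) {0..1}"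
    by (rule fundamental_theorem_of_calculus)
      (auto intro!: derivative_eq_intros simp flip: has_real_derivative_iff_has_vector_derivative)
  then show ?thesis by (simp add: field_simps)
qed

lemma linear_weight_powr_has_integral:
  fixes u v s :: real
  assumes "0 < s"
  shows "((\<lambda>t. (t * v + (1 - t) * u) * t powr s) has_integral
           ((s + 1) * v + u) / ((s + 1) * (s + 2))) {0..1}"
proof -
  have "((\<lambda>t. (v - u) * t powr (s + 1) + u * t powr s) has_integral
      (v - u) * (1 powr (s + 1 + 1) / (s + 1 + 1)) + u * (1 powr (s + 1) / (s + 1))) {0..1}"
    using assms by (intro has_integral_add has_integral_mult_right has_integral_powr_from_0) auto
  also have "(v - u) * (1 powr (s + 1 + 1) / (s + 1 + 1)) + u * (1 powr (s + 1) / (s + 1))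
      = ((s + 1) * v + u) / ((s + 1) * (s + 2))"
    using assms by (simp add: divide_simps) (simp add: algebra_simps)
  finally show ?thesis
    by (rule has_integral_eq[rotated]) (auto simp: powr_add algebra_simps)
qed

text \<open>The summand with \<open>(1 - t) powr s\<close> is the reflection \<open>t \<mapsto> 1 - t\<close> of the other one with \<open>u\<close> and
  \<open>v\<close> interchanged, because this reflection interchanges \<open>u\<close> and \<open>v\<close> in the weight.\<close>

lemma weighted_s_convex_majorant_has_integral:
  fixes u v s \<alpha> \<beta> :: real
  assumes "0 < s"
  shows "((\<lambda>t. (t * v + (1 - t) * u) * (t powr s * \<alpha> + (1 - t) powr s * \<beta>)) has_integral
           1 / ((s + 1) * (s + 2)) * (((s + 1) * v + u) * \<alpha> + ((s + 1) * u + v) * \<beta>)) {0..1}"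
proof -
  have "((\<lambda>t. ((1 - t) * u + t * v) * (1 - t) powr s) has_integral
      ((s + 1) * u + v) / ((s + 1) * (s + 2))) {0..1}"
    using has_integral_affinity[of _ _ 0 1 "-1" 1, OF linear_weight_powr_has_integral
        [OF assms, of u v, folded box_real(2)]]
    by simp
  then have "((\<lambda>t. (t * v + (1 - t) * u) * t powr s * \<alpha> + ((1 - t) * u + t * v) * (1 - t) powr s * \<beta>)
      has_integral ((s + 1) * v + u) / ((s + 1) * (s + 2)) * \<alpha>
        + ((s + 1) * u + v) / ((s + 1) * (s + 2)) * \<beta>) {0..1}"
    by (intro has_integral_add has_integral_mult_left linear_weight_powr_has_integral assms)
  then show ?thesis
    by (simp add: algebra_simps add_divide_distrib)
qed

text \<open>Integration by parts and the substitution \<open>y = t * b + (1 - t) * a\<close> in one step, by exhibiting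
  the antiderivative. Working with an antiderivative \<open>F\<close> of \<open>f\<close>, and with the factor \<open>(b - a)\<^sup>2\<close>
  instead of a division by \<open>b - a\<close>, makes the degenerate segment \<open>a = b\<close> an ordinary case.\<close>

lemma weighted_derivative_has_integral:
  fixes F f f' :: "real \<Rightarrow> real" and a b u v :: real
  assumes "a \<le> b"
    and F: "\<And>y. y \<in> {a..b} \<Longrightarrow> (F has_real_derivative f y) (at y)"
    and f: "\<And>y. y \<in> {a..b} \<Longrightarrow> (f has_real_derivative f' y) (at y)"
  shows "((\<lambda>t. (t * v + (1 - t) * u) * ((b - a)\<^sup>2 * f' (t * b + (1 - t) * a))) has_integral
           (b - a) * (v * f b - u * f a) - (v - u) * (F b - F a)) {0..1}"
proof -
  let ?y = "\<lambda>t::real. t * b + (1 - t) * a"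
  let ?G = "\<lambda>t. (b - a) * ((t * v + (1 - t) * u) * f (?y t)) - (v - u) * F (?y t)"
  have deriv: "(?G has_real_derivative (t * v + (1 - t) * u) * ((b - a)\<^sup>2 * f' (?y t))) (at t within {0..1})"
    if "t \<in> {0..1}" for t
  proof -
    have "?y t \<in> {a..b}"
      using convexD_alt[OF convex_real_interval(5), of a a b b t] that \<open>a \<le> b\<close>
      by (simp add: algebra_simps)
    note F' = DERIV_chain2[where g = ?y, OF F[OF this]] and f' = DERIV_chain2[where g = ?y, OF f[OF this]]
    show ?thesis
      by (rule derivative_eq_intros F' f' refl)+ (simp add: algebra_simps power2_eq_square)
  qed
  have "((\<lambda>t. (t * v + (1 - t) * u) * ((b - a)\<^sup>2 * f' (?y t))) has_integral ?G 1 - ?G 0) {0..1}"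
    by (rule fundamental_theorem_of_calculus)
      (use deriv in \<open>auto simp flip: has_real_derivative_iff_has_vector_derivative\<close>)
  then show ?thesis by (simp add: algebra_simps)
qed

text \<open>The estimate on one segment. The theorem uses it for \<open>[x, v]\<close> and for \<open>[u, x]\<close>; the weight runs
  from \<open>u\<close> to \<open>v\<close> in both cases, so \<open>a\<close> and \<open>b\<close> are independent of \<open>u\<close> and \<open>v\<close>.\<close>

lemma s_convex_segment_bound:
  fixes F f f' :: "real \<Rightarrow> real" and a b u v q s :: real
  assumes "a \<le> b" "0 < u" "0 < v" "1 \<le> q" "0 < s"
    and F: "\<And>y. y \<in> {a..b} \<Longrightarrow> (F has_real_derivative f y) (at y)"
    and f: "\<And>y. y \<in> {a..b} \<Longrightarrow> (f has_real_derivative f' y) (at y)"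
    and convex: "s_convex_on s {a..b} (\<lambda>y. \<bar>f' y\<bar> powr q)"
  shows "\<bar>(b - a) * (v * f b - u * f a) - (v - u) * (F b - F a)\<bar>
    \<le> (b - a)\<^sup>2 * arith_mean u v powr (1 - 1 / q) * (1 / ((s + 1) * (s + 2))) powr (1 / q)
        * (((s + 1) * v + u) * \<bar>f' b\<bar> powr q + ((s + 1) * u + v) * \<bar>f' a\<bar> powr q) powr (1 / q)"
proof -
  let ?I = "(b - a) * (v * f b - u * f a) - (v - u) * (F b - F a)"
  let ?M = "((s + 1) * v + u) * \<bar>f' b\<bar> powr q + ((s + 1) * u + v) * \<bar>f' a\<bar> powr q"
  let ?K = "1 / ((s + 1) * (s + 2))"
  define D where "D = (b - a)\<^sup>2"
  define h where "h t = t powr s * \<bar>f' b\<bar> powr q + (1 - t) powr s * \<bar>f' a\<bar> powr q" for t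
  have "0 \<le> D" by (simp add: D_def)
  have "\<bar>D * f' (t * b + (1 - t) * a)\<bar> powr q \<le> D powr q * h t" if "t \<in> {0..1}" for t
  proof -
    have "\<bar>f' (t * b + (1 - t) * a)\<bar> powr q \<le> h t"
      using convex that \<open>a \<le> b\<close> unfolding s_convex_on_def h_def by auto
    then show ?thesis
      using \<open>0 \<le> D\<close> by (simp add: abs_mult powr_mult mult_left_mono)
  qed
  moreover have "((\<lambda>t. (t * v + (1 - t) * u) * (D powr q * h t)) has_integral D powr q * (?K * ?M)) {0..1}"
    using has_integral_mult_right[OF weighted_s_convex_majorant_has_integral[OF \<open>0 < s\<close>],
        of "D powr q" v u "\<bar>f' b\<bar> powr q" "\<bar>f' a\<bar> powr q"]
    by (simp add: h_def mult.left_commute)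
  moreover have "((\<lambda>t. (t * v + (1 - t) * u) * (D * f' (t * b + (1 - t) * a))) has_integral ?I) {0..1}"
    unfolding D_def by (rule weighted_derivative_has_integral[OF \<open>a \<le> b\<close> F f])
  ultimately have "\<bar>?I\<bar> \<le> ((u + v) / 2) powr (1 - 1 / q) * (D powr q * (?K * ?M)) powr (1 / q)"
    using assms
    by (intro weighted_power_mean_bound[where S = "{0..1}" and w = "\<lambda>t. t * v + (1 - t) * u",
          OF \<open>1 \<le> q\<close> _ _ linear_weight_has_integral]) auto
  also have "(D powr q * (?K * ?M)) powr (1 / q) = D * (?K powr (1 / q) * ?M powr (1 / q))"
    using assms \<open>0 \<le> D\<close> by (simp only: powr_mult) (simp add: powr_powr)
  finally show ?thesis
    by (simp add: D_def arith_mean_def mult_ac)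
qed

theorem theorem7:
  fixes f :: "real \<Rightarrow> real" and u v q s x :: real
  assumes "f differentiable_on {0<..}"
    and "0 < u" and "u < v"
    and "deriv f absolutely_integrable_on {u..v}"
    and "q \<ge> 1"
    and "0 < s" and "s \<le> 1"
    and "s_convex_on s {u..v} (\<lambda>y. \<bar>deriv f y\<bar> powr q)"
    and "x \<in> {u..v}"
  shows "\<bar>((v - x) * (v * f v - u * f x) + (x - u) * (v * f x - u * f u)) / (v - u)\<^sup>2
            - 1 / (v - u) * integral {u..v} f\<bar>
    \<le> (v - x)\<^sup>2 / (v - u)\<^sup>2 * arith_mean u v powr (1 - 1 / q)
         * (1 / ((s + 1) * (s + 2))) powr (1 / q)
         * (((s + 1) * u + v) * \<bar>deriv f x\<bar> powr q
             + ((s + 1) * v + u) * \<bar>deriv f v\<bar> powr q) powr (1 / q)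
      + (x - u)\<^sup>2 / (v - u)\<^sup>2 * arith_mean u v powr (1 - 1 / q)
         * (1 / ((s + 1) * (s + 2))) powr (1 / q)
         * (((s + 1) * v + u) * \<bar>deriv f x\<bar> powr q
             + ((s + 1) * u + v) * \<bar>deriv f u\<bar> powr q) powr (1 / q)"
proof -
  \<comment> \<open>The base point lies to the left of \<open>u\<close>, so that \<open>F\<close> has a two-sided derivative even at \<open>u\<close>.\<close>
  define F where "F y = integral {u / 2..y} f" for y
  have f: "(f has_real_derivative deriv f y) (at y)" if "0 < y" for y
  proof -
    have "f differentiable at y"
      using assms(1) that by (simp add: differentiable_on_eq_differentiable_at)
    then show ?thesis
      by (simp add: DERIV_deriv_iff_real_differentiable)
  qed
  have cont: "continuous_on {u / 2..v + 1} f"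
    using assms(1) \<open>0 < u\<close>
    by (intro continuous_on_subset[OF differentiable_imp_continuous_on[OF assms(1)]]) auto
  have F: "(F has_real_derivative f y) (at y)" if "y \<in> {u..v}" for y
  proof -
    have "(F has_real_derivative f y) (at y within {u / 2..v + 1})"
      unfolding F_def using that \<open>0 < u\<close> by (intro integral_has_real_derivative[OF cont]) auto
    then show ?thesis
      using that \<open>0 < u\<close> by (simp add: at_within_Icc_at)
  qed
  have int_f: "integral {u..v} f = F v - F u"
  proof -
    have "f integrable_on {u / 2..v}"
      using cont by (intro integrable_continuous_real continuous_on_subset[OF cont]) auto
    then show ?thesis
      unfolding F_def using Henstock_Kurzweil_Integration.integral_combine[of "u / 2" u v f] assms(2,3) by simp
  qed
  let ?q = "\<lambda>y. \<bar>deriv f y\<bar> powr q"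
  let ?C = "arith_mean u v powr (1 - 1 / q) * (1 / ((s + 1) * (s + 2))) powr (1 / q)"
  let ?R = "(((s + 1) * u + v) * ?q x + ((s + 1) * v + u) * ?q v) powr (1 / q)"
  let ?L = "(((s + 1) * v + u) * ?q x + ((s + 1) * u + v) * ?q u) powr (1 / q)"
  let ?I\<^sub>R = "(v - x) * (v * f v - u * f x) - (v - u) * (F v - F x)"
  let ?I\<^sub>L = "(x - u) * (v * f x - u * f u) - (v - u) * (F x - F u)"
  have convex: "s_convex_on s {a..b} ?q" if "{a..b} \<subseteq> {u..v}" for a b
    using assms(8) that unfolding s_convex_on_def by blast
  have right: "\<bar>?I\<^sub>R\<bar> \<le> (v - x)\<^sup>2 * ?C * ?R"
    using s_convex_segment_bound[of x v u v q s F f "deriv f"] assms F f convex[of x v]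
    by (simp add: mult.assoc add.commute)
  have left: "\<bar>?I\<^sub>L\<bar> \<le> (x - u)\<^sup>2 * ?C * ?L"
    using s_convex_segment_bound[of u x u v q s F f "deriv f"] assms F f convex[of u x]
    by (simp add: mult.assoc)
  have "((v - x) * (v * f v - u * f x) + (x - u) * (v * f x - u * f u)) / (v - u)\<^sup>2
      - 1 / (v - u) * integral {u..v} f = (?I\<^sub>R + ?I\<^sub>L) / (v - u)\<^sup>2"
  proof -
    have "1 / (v - u) * integral {u..v} f = (v - u) * (F v - F u) / (v - u)\<^sup>2"
      using \<open>u < v\<close> by (simp add: int_f power2_eq_square)
    then show ?thesis
      by (simp add: diff_divide_distrib[symmetric]) (simp add: algebra_simps)
  qed
  also have "\<bar>\<dots>\<bar> \<le> ((v - x)\<^sup>2 * ?C * ?R + (x - u)\<^sup>2 * ?C * ?L) / (v - u)\<^sup>2"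
    unfolding abs_divide abs_power2
    by (rule divide_right_mono[OF order_trans[OF abs_triangle_ineq add_mono[OF right left]]]) simp
  finally show ?thesis
    by (simp add: add_divide_distrib mult.assoc)
qed

end
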